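(* Let $G$ be an oriented graph (possibly with parallel arcs) of maximum degree $\Delta$ with maximum out-degree at most $d$. Let $C$ be a set of $k$ colors, and let each arc $e\in A(G)$ have an associated conflict $f(e)\in C^2$. If $f$ is uniquely restrictive and \[k \geq 2\sqrt{d\left[1+\log((d+1)\Delta)\right]},\] then $G$ has a single-conflict coloring with respect to $f$ and $C$.
   Context: An oriented graph here is a loopless directed multigraph; $A(G)$ is its arc set, $A^+(v)$ and $A^-(v)$ the sets of arcs leaving and entering $v$; two arcs are parallel if they join the same pair of vertices. For an arc $e=(u,v)$ with conflict $f(e)=(c_1,c_2)$, the first entry corresponds to $u$ and the second to $v$; write $\mathrm{cc}(u,e)=c_1$ and $\mathrm{cc}(v,e)=c_2$. A coloring $\phi:V(G)\to C$ is a single-conflict coloring with respect to $f$ and $C$ if $(\phi(u),\phi(v))\neq f(e)$ for every arc $e=(u,v)$. The conflict function $f$ is uniquely restrictive at $w$ if for every pair of parallel arcs $e_1,e_2\in A^-(w)$ (with common other endpoint $v$) such that $\mathrm{cc}(w,e_1)=\mathrm{cc}(w,e_2)$, it holds that $\mathrm{cc}(v,e_1)=\mathrm{cc}(v,e_2)$; $f$ is uniquely restrictive if it is uniquely restrictive at every vertex. The degree of a vertex counts all incident arcs. $\log$ is the natural logarithm. *)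

theory Defs
  imports Complex_Main "Graph_Theory.Digraph"
begin

locale oriented_graph = fin_digraph + loopfree_digraph

definition vertex_degree :: "('a, 'b) pre_digraph \<Rightarrow> 'a \<Rightarrow> nat" where
  "vertex_degree G v = card (in_arcs G v \<union> out_arcs G v)"

(* The inserted 0 only fixes the value for the null graph. *)
definition max_degree :: "('a, 'b) pre_digraph \<Rightarrow> nat" where
  "max_degree G = Max (insert 0 (vertex_degree G ` verts G))"

definition max_out_degree :: "('a, 'b) pre_digraph \<Rightarrow> nat" where
  "max_out_degree G = Max (insert 0 (out_degree G ` verts G))"

definition parallel_arcs :: "('a, 'b) pre_digraph \<Rightarrow> 'b \<Rightarrow> 'b \<Rightarrow> bool" where
  "parallel_arcs G e1 e2 \<longleftrightarrow> {tail G e1, head G e1} = {tail G e2, head G e2}"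

(* Meaningful only when v is an endpoint of the (non-loop) arc e. *)
definition cc :: "('a, 'b) pre_digraph \<Rightarrow> ('b \<Rightarrow> 'c \<times> 'c) \<Rightarrow> 'a \<Rightarrow> 'b \<Rightarrow> 'c" where
  "cc G f v e = (if v = tail G e then fst (f e) else snd (f e))"

(* Both arcs enter w, so their common other endpoint is the tail of either one. *)
definition uniquely_restrictive_at ::
    "('a, 'b) pre_digraph \<Rightarrow> ('b \<Rightarrow> 'c \<times> 'c) \<Rightarrow> 'a \<Rightarrow> bool" where
  "uniquely_restrictive_at G f w \<longleftrightarrow>
    (\<forall>e1 \<in> in_arcs G w. \<forall>e2 \<in> in_arcs G w. \<forall>v.
      parallel_arcs G e1 e2 \<and> v = tail G e1 \<and> v = tail G e2 \<and>
      cc G f w e1 = cc G f w e2 \<longrightarrow> cc G f v e1 = cc G f v e2)"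

definition uniquely_restrictive ::
    "('a, 'b) pre_digraph \<Rightarrow> ('b \<Rightarrow> 'c \<times> 'c) \<Rightarrow> bool" where
  "uniquely_restrictive G f \<longleftrightarrow> (\<forall>w \<in> verts G. uniquely_restrictive_at G f w)"

definition single_conflict_coloring ::
    "('a, 'b) pre_digraph \<Rightarrow> ('b \<Rightarrow> 'c \<times> 'c) \<Rightarrow> 'c set \<Rightarrow> ('a \<Rightarrow> 'c) \<Rightarrow> bool" where
  "single_conflict_coloring G f C \<phi> \<longleftrightarrow>
    (\<forall>v \<in> verts G. \<phi> v \<in> C) \<and>
    (\<forall>e \<in> arcs G. (\<phi> (tail G e), \<phi> (head G e)) \<noteq> f e)"

end

theory Submission
  imports Defs "HOL-Probability.Probability"
begin

text \<open>
  Give every vertex \<open>u\<close> a random list \<open>S u\<close> of colours, each colour being chosen independently with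
  probability \<open>q = k / (2 d)\<close>. Call \<open>c\<close> usable at \<open>u\<close> if \<open>c \<in> S u\<close> and no arc \<open>e = (u, v)\<close> with
  conflict \<open>(c, c')\<close> has \<open>c' \<in> S v\<close>. Colouring every vertex with a usable colour avoids all conflicts.
  Since \<open>f\<close> is uniquely restrictive, the usability events of different colours at \<open>u\<close> depend on
  disjoint sets of choices, so they are independent and \<open>u\<close> has no usable colour with probability at
  most \<open>exp (- k\<^sup>2 / (4 d)) \<le> 1 / (exp 1 * (d + 1) * \<Delta>)\<close>. This event is determined by the lists of the
  closed out-neighbourhood of \<open>u\<close>, which meets fewer than \<open>(d + 1) * \<Delta>\<close> others, so the symmetric
  Lovasz local lemma applies. (If \<open>k\<close> exceeds the maximum out-degree, every vertex has a colour that
  occurs in no conflict of its outgoing arcs.)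
\<close>

section \<open>The local lemma\<close>

context prob_space
begin

text \<open>Chain rule: the events of \<open>T\<close> are avoided one after another, and by
  \<open>step\<close> each keeps at least the fraction \<open>1 - x j\<close> of the probability so
  far. Conditional bounds are multiplied out, so null events need no separate treatment.\<close>

lemma prob_avoid_extend:
  assumes A: "\<And>j. j \<in> T \<Longrightarrow> A j \<in> events"
    and S: "\<And>j. j \<in> S \<Longrightarrow> A j \<in> events"
    and fin: "finite T" "finite S"
    and x: "\<And>j. j \<in> T \<Longrightarrow> x j \<le> 1"
    and step: "\<And>j T'. j \<in> T \<Longrightarrow> T' \<subseteq> T - {j} \<Longrightarrow>
      prob (A j \<inter> (space M - (\<Union>i\<in>S \<union> T'. A i))) \<le> x j * prob (space M - (\<Union>i\<in>S \<union> T'. A i))"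
  shows "(\<Prod>j\<in>T. 1 - x j) * prob (space M - (\<Union>i\<in>S. A i)) \<le> prob (space M - (\<Union>i\<in>S \<union> T. A i))"
  using fin(1) A x step
proof (induction T rule: finite_induct)
  case empty
  then show ?case by simp
next
  case (insert j T)
  let ?G = "space M - (\<Union>i\<in>S \<union> T. A i)"
  have ev: "?G \<in> events" "A j \<in> events"
    using insert.prems insert.hyps S fin by (auto intro!: sets.Diff sets.finite_UN)
  have "(\<Prod>i\<in>insert j T. 1 - x i) * prob (space M - (\<Union>i\<in>S. A i))
      = (1 - x j) * ((\<Prod>i\<in>T. 1 - x i) * prob (space M - (\<Union>i\<in>S. A i)))"
    using insert.hyps by simp
  also have "\<dots> \<le> (1 - x j) * prob ?G"
    using insert.hyps insert.prems(2)
    by (intro mult_left_mono insert.IH insert.prems) auto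
  also have "\<dots> \<le> prob ?G - prob (A j \<inter> ?G)"
    using insert.prems(3)[of j T] insert.hyps by (auto simp: algebra_simps)
  also have "\<dots> = prob (?G - A j \<inter> ?G)"
    using ev by (intro finite_measure_Diff[symmetric]) auto
  also have "?G - A j \<inter> ?G = space M - (\<Union>i\<in>S \<union> insert j T. A i)"
    by auto
  finally show ?case .
qed

theorem lovasz_local_lemma:
  assumes I: "finite I"
    and A: "\<And>i. i \<in> I \<Longrightarrow> A i \<in> events"
    and N: "\<And>i. i \<in> I \<Longrightarrow> N i \<subseteq> I"
    and indep: "\<And>i J. i \<in> I \<Longrightarrow> J \<subseteq> I - N i - {i} \<Longrightarrow>
      prob (A i \<inter> (space M - (\<Union>j\<in>J. A j))) = prob (A i) * prob (space M - (\<Union>j\<in>J. A j))"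
    and x: "\<And>i. i \<in> I \<Longrightarrow> 0 \<le> x i" "\<And>i. i \<in> I \<Longrightarrow> x i < 1"
    and bound: "\<And>i. i \<in> I \<Longrightarrow> prob (A i) \<le> x i * (\<Prod>j\<in>N i. 1 - x j)"
  shows "prob (space M - (\<Union>i\<in>I. A i)) > 0"
proof -
  let ?G = "\<lambda>S. space M - (\<Union>i\<in>S. A i)"
  \<comment> \<open>The usual bound \<open>x i\<close> on the conditional probability of
    \<open>A i\<close>, given that no event of \<open>S\<close> occurs, with the denominator
    cleared.\<close>
  have key: "prob (A i \<inter> ?G S) \<le> x i * prob (?G S)" if "S \<subseteq> I" "i \<in> I - S" for i S
  proof -
    have "finite S" using that I finite_subset by blast
    then show ?thesis using that
    proof (induction S arbitrary: i rule: finite_psubset_induct)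
      case (psubset S)
      define S1 S2 where "S1 = S \<inter> N i" and "S2 = S - N i"
      have fin: "finite S1" "finite S2" "finite (N i)"
        using psubset.hyps psubset.prems I N[of i] by (auto simp: S1_def S2_def intro: finite_subset)
      have S: "S = S2 \<union> S1" by (auto simp: S1_def S2_def)
      have i: "i \<in> I" using psubset by simp
      \<comment> \<open>The induction hypothesis supplies the step condition:
        \<open>S2 \<union> T'\<close> lies in \<open>S\<close> and omits \<open>j \<in> S\<close>,
        so it is a proper subset.\<close>
      have ext: "(\<Prod>j\<in>S1. 1 - x j) * prob (?G S2) \<le> prob (?G (S2 \<union> S1))"
      proof (rule prob_avoid_extend)
        fix j T' assume jT: "j \<in> S1" "T' \<subseteq> S1 - {j}"
        have "S2 \<union> T' \<subset> S" using jT by (auto simp: S1_def S2_def)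
        moreover have "j \<in> I - (S2 \<union> T')" using jT psubset.prems by (auto simp: S1_def S2_def)
        ultimately show "prob (A j \<inter> ?G (S2 \<union> T')) \<le> x j * prob (?G (S2 \<union> T'))"
          using psubset.prems by (intro psubset.IH) auto
      qed (use psubset.prems fin A less_imp_le[OF x(2)] in \<open>auto simp: S1_def S2_def\<close>)
      have ev: "A i \<inter> ?G S2 \<in> events"
        using A i psubset.prems fin by (auto simp: S2_def intro!: sets.Diff sets.finite_UN)
      \<comment> \<open>Forgetting the neighbours \<open>S1\<close> only enlarges the event and
        leaves events of which \<open>A i\<close> is independent; \<open>ext\<close> restores
        \<open>S1\<close> at the end.\<close>
      have "prob (A i \<inter> ?G S) \<le> prob (A i \<inter> ?G S2)"
        using ev by (intro finite_measure_mono) (auto simp: S2_def)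
      also have "\<dots> = prob (A i) * prob (?G S2)"
        using psubset.prems by (intro indep) (auto simp: S2_def)
      also have "\<dots> \<le> x i * (\<Prod>j\<in>N i. 1 - x j) * prob (?G S2)"
        using bound[OF i] by (intro mult_right_mono) auto
      also have "\<dots> \<le> x i * (\<Prod>j\<in>S1. 1 - x j) * prob (?G S2)"
      proof (intro mult_right_mono mult_left_mono)
        have "(\<Prod>j\<in>N i. 1 - x j) = (\<Prod>j\<in>S1. 1 - x j) * (\<Prod>j\<in>N i - S1. 1 - x j)"
          using fin by (subst prod.subset_diff[of S1]) (auto simp: S1_def)
        also have "\<dots> \<le> (\<Prod>j\<in>S1. 1 - x j) * 1"
          using N[OF i] x psubset.prems
          by (intro mult_left_mono prod_le_1 prod_nonneg) (auto simp: S1_def less_imp_le subset_iff)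
        finally show "(\<Prod>j\<in>N i. 1 - x j) \<le> (\<Prod>j\<in>S1. 1 - x j)" by simp
      qed (use x i in auto)
      also have "\<dots> \<le> x i * prob (?G S)"
        using ext x(1)[OF i] unfolding S by (simp add: mult.assoc mult_left_mono)
      finally show ?case .
    qed
  qed
  have "(\<Prod>j\<in>I. 1 - x j) * prob (?G {}) \<le> prob (?G ({} \<union> I))"
  proof (rule prob_avoid_extend)
    show "prob (A j \<inter> ?G ({} \<union> T)) \<le> x j * prob (?G ({} \<union> T))" if "j \<in> I" "T \<subseteq> I - {j}" for j T
      using key[of T j] that by auto
  qed (use I A less_imp_le[OF x(2)] in auto)
  moreover have "(\<Prod>j\<in>I. 1 - x j) > 0" using x by (intro prod_pos) auto
  ultimately show ?thesis by (simp add: prob_space)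
qed

text \<open>Every weight is \<open>1 / D\<close>. At most \<open>D - 1\<close> neighbours contribute
  a factor, and \<open>(1 - 1 / D) ^ (D - 1)\<close> is at least \<open>1 / exp 1\<close>.\<close>

corollary lovasz_local_lemma_symmetric:
  fixes D :: nat
  assumes I: "finite I"
    and A: "\<And>i. i \<in> I \<Longrightarrow> A i \<in> events"
    and N: "\<And>i. i \<in> I \<Longrightarrow> N i \<subseteq> I"
    and indep: "\<And>i J. i \<in> I \<Longrightarrow> J \<subseteq> I - N i - {i} \<Longrightarrow>
      prob (A i \<inter> (space M - (\<Union>j\<in>J. A j))) = prob (A i) * prob (space M - (\<Union>j\<in>J. A j))"
    and D: "2 \<le> D" "\<And>i. i \<in> I \<Longrightarrow> card (N i) < D"
    and bound: "\<And>i. i \<in> I \<Longrightarrow> prob (A i) \<le> 1 / (exp 1 * real D)"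
  shows "prob (space M - (\<Union>i\<in>I. A i)) > 0"
proof (rule lovasz_local_lemma[where N = N and x = "\<lambda>_. 1 / real D"])
  fix i assume i: "i \<in> I"
  have pos: "real D - 1 > 0" using D by simp
  \<comment> \<open>This is \<open>1 + y \<le> exp y\<close> at \<open>y = 1 / (D - 1)\<close>,
    chosen because the reciprocal of \<open>1 + y\<close> is \<open>1 - 1 / D\<close>.\<close>
  have "(1 + 1 / (real D - 1)) ^ (D - 1) \<le> exp (1 / (real D - 1)) ^ (D - 1)"
    using pos by (intro power_mono exp_ge_add_one_self) auto
  also have "\<dots> = exp (real (D - 1) * (1 / (real D - 1)))"
    by (simp only: exp_of_nat_mult)
  also have "\<dots> = exp 1"
    using D pos by (simp add: of_nat_diff)
  finally have "1 / exp 1 \<le> 1 / (1 + 1 / (real D - 1)) ^ (D - 1)"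
    using pos by (intro divide_left_mono mult_pos_pos) (auto intro!: zero_less_power add_pos_pos)
  also have "\<dots> = (1 / (1 + 1 / (real D - 1))) ^ (D - 1)"
    by (simp add: power_one_over)
  also have "1 / (1 + 1 / (real D - 1)) = 1 - 1 / real D"
    using pos by (simp add: field_simps)
  also have "(1 - 1 / real D) ^ (D - 1) \<le> (1 - 1 / real D) ^ card (N i)"
    using D(1) D(2)[OF i] by (intro power_decreasing) auto
  finally have "1 / real D * (1 / exp 1) \<le> 1 / real D * (1 - 1 / real D) ^ card (N i)"
    by (intro mult_left_mono) auto
  then show "prob (A i) \<le> 1 / real D * (\<Prod>j\<in>N i. 1 - 1 / real D)"
    using bound[OF i] by (simp add: mult.commute)
qed (use assms in auto)

end

section \<open>Independence of disjoint coordinates\<close>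

text \<open>Combinatorial stand-in for measurability with respect to the coordinates in
  \<open>X\<close>; in a product measure, disjoint coordinate sets give independent events.\<close>

definition determined_by :: "'a set \<Rightarrow> ('a \<Rightarrow> 'b) set \<Rightarrow> bool" where
  "determined_by X E \<longleftrightarrow> (\<forall>f g. (\<forall>x\<in>X. f x = g x) \<longrightarrow> (f \<in> E \<longleftrightarrow> g \<in> E))"

lemma determined_by_INT:
  assumes "\<And>j. j \<in> J \<Longrightarrow> determined_by (X j) (E j)"
  shows "determined_by (\<Union>j\<in>J. X j) (\<Inter>j\<in>J. E j)"
  unfolding determined_by_def
proof (intro allI impI)
  fix f g :: "'b \<Rightarrow> 'c" assume fg: "\<forall>x\<in>(\<Union>j\<in>J. X j). f x = g x"
  have "f \<in> E j \<longleftrightarrow> g \<in> E j" if "j \<in> J" for j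
    using fg that assms[OF that] unfolding determined_by_def by (metis UN_I)
  then show "f \<in> (\<Inter>j\<in>J. E j) \<longleftrightarrow> g \<in> (\<Inter>j\<in>J. E j)" by auto
qed

lemma determined_by_mono:
  assumes "X \<subseteq> Y" "determined_by X E"
  shows "determined_by Y E"
  unfolding determined_by_def
proof (intro allI impI)
  fix f g :: "'a \<Rightarrow> 'b" assume "\<forall>x\<in>Y. f x = g x"
  then have "\<forall>x\<in>X. f x = g x" using assms(1) by auto
  then show "f \<in> E \<longleftrightarrow> g \<in> E" using assms(2) unfolding determined_by_def by blast
qed

lemma determined_by_Compl: "determined_by X E \<Longrightarrow> determined_by X (- E)"
  unfolding determined_by_def by blast

text \<open>Intersecting with the supports, which are countable, changes no probability and reduces
  the claim to the product rule for countable sets.\<close>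

lemma measure_pair_pmf_Times:
  "measure_pmf.prob (pair_pmf p q) (A \<times> B) = measure_pmf.prob p A * measure_pmf.prob q B"
proof -
  have "measure_pmf.prob (pair_pmf p q) (A \<times> B) =
      measure_pmf.prob (pair_pmf p q) ((A \<inter> set_pmf p) \<times> (B \<inter> set_pmf q))"
    by (subst measure_Int_set_pmf[symmetric]) (simp add: Times_Int_Times)
  also have "\<dots> = measure_pmf.prob p (A \<inter> set_pmf p) * measure_pmf.prob q (B \<inter> set_pmf q)"
    by (intro measure_pmf_prob_product) auto
  finally show ?thesis by (simp add: measure_Int_set_pmf)
qed

text \<open>The product splits into independent parts on \<open>X\<close> and \<open>I - X\<close>.
  Under the map gluing them, \<open>E\<close> constrains only the first part and \<open>F\<close>
  only the second, so the preimage of \<open>E \<inter> F\<close> is a rectangle.\<close>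

lemma Pi_pmf_prob_Int:
  fixes E F :: "('a \<Rightarrow> 'b) set"
  assumes I: "finite I" "X \<subseteq> I" and disj: "X \<inter> Y = {}"
    and E: "determined_by X E" and F: "determined_by Y F"
  shows "measure_pmf.prob (Pi_pmf I dflt p) (E \<inter> F) =
    measure_pmf.prob (Pi_pmf I dflt p) E * measure_pmf.prob (Pi_pmf I dflt p) F"
proof -
  let ?P = "measure_pmf.prob (Pi_pmf I dflt p)"
  let ?Q = "Pi_pmf X dflt p" and ?R = "Pi_pmf (I - X) dflt p"
  have "Pi_pmf I dflt p = map_pmf (\<lambda>(f, g) x. if x \<in> X then f x else g x) (pair_pmf ?Q ?R)"
    using Pi_pmf_union[of X "I - X" dflt p] I
    by (simp add: finite_subset Un_absorb1)
  moreover have "(\<lambda>(f, g) x. if x \<in> X then f x else g x) -` (E' \<inter> F') = E' \<times> F'"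
    if E': "determined_by X E'" and F': "determined_by Y F'" for E' F' :: "('a \<Rightarrow> 'b) set"
  proof -
    have "(\<lambda>x. if x \<in> X then f x else g x) \<in> E' \<longleftrightarrow> f \<in> E'" for f g
      using E'[unfolded determined_by_def, rule_format, of "\<lambda>x. if x \<in> X then f x else g x" f] by simp
    moreover have "(\<lambda>x. if x \<in> X then f x else g x) \<in> F' \<longleftrightarrow> g \<in> F'" for f g
      using F'[unfolded determined_by_def, rule_format, of "\<lambda>x. if x \<in> X then f x else g x" g] disj
      by (metis disjoint_iff)
    ultimately show ?thesis by auto
  qed
  ultimately have *: "?P (E' \<inter> F') = measure_pmf.prob ?Q E' * measure_pmf.prob ?R F'"
    if "determined_by X E'" "determined_by Y F'" for E' F' :: "('a \<Rightarrow> 'b) set"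
    using that by (simp add: measure_pair_pmf_Times del: vimage_Int)
  have U: "determined_by Z UNIV" for Z :: "'a set" by (simp add: determined_by_def)
  \<comment> \<open>Replacing one event by \<open>UNIV\<close> identifies each factor with a
    probability under the full product.\<close>
  have "?P E = measure_pmf.prob ?Q E" "?P F = measure_pmf.prob ?R F"
    using *[OF E U] *[OF U F] by simp_all
  then show ?thesis using *[OF E F] by simp
qed

lemma Pi_pmf_prob_INT:
  assumes "finite J" "finite I" "\<And>j. j \<in> J \<Longrightarrow> X j \<subseteq> I"
    and "\<And>j. j \<in> J \<Longrightarrow> determined_by (X j) (E j)"
    and "\<And>i j. i \<in> J \<Longrightarrow> j \<in> J \<Longrightarrow> i \<noteq> j \<Longrightarrow> X i \<inter> X j = {}"
  shows "measure_pmf.prob (Pi_pmf I dflt p) (\<Inter>j\<in>J. E j) =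
    (\<Prod>j\<in>J. measure_pmf.prob (Pi_pmf I dflt p) (E j))"
  using assms(1,3-)
proof (induction J rule: finite_induct)
  case empty
  then show ?case by simp
next
  case (insert j J)
  have "measure_pmf.prob (Pi_pmf I dflt p) (E j \<inter> (\<Inter>i\<in>J. E i)) =
     measure_pmf.prob (Pi_pmf I dflt p) (E j) * measure_pmf.prob (Pi_pmf I dflt p) (\<Inter>i\<in>J. E i)"
  proof (rule Pi_pmf_prob_Int)
    show "X j \<inter> (\<Union>i\<in>J. X i) = {}"
    proof -
      have "X j \<inter> X i = {}" if "i \<in> J" for i
        using insert.prems(3)[of j i] insert.hyps(2) that by auto
      then show ?thesis by auto
    qed
    show "determined_by (\<Union>i\<in>J. X i) (\<Inter>i\<in>J. E i)"
      by (rule determined_by_INT) (use insert.prems in auto)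
  qed (use assms(2) insert.prems in auto)
  moreover have "measure_pmf.prob (Pi_pmf I dflt p) (\<Inter>i\<in>J. E i) =
      (\<Prod>j\<in>J. measure_pmf.prob (Pi_pmf I dflt p) (E j))"
    using insert.prems by (intro insert.IH) auto
  ultimately show ?case using insert.hyps by simp
qed

lemma Pi_bernoulli_prob_single:
  assumes I: "finite I" "a \<in> I" "Y \<subseteq> I" "a \<notin> Y" and q: "0 \<le> q" "q \<le> 1"
  shows "measure_pmf.prob (Pi_pmf I dflt (\<lambda>_. bernoulli_pmf q)) {S. S a \<and> (\<forall>y\<in>Y. \<not> S y)} =
    q * (1 - q) ^ card Y"
proof -
  let ?B = "\<lambda>x. if x = a then {True} else if x \<in> Y then {False} else (UNIV :: bool set)"
  \<comment> \<open>As a box, the event has probability equal to a product over \<open>I\<close>, in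
    which coordinates outside \<open>insert a Y\<close> contribute 1.\<close>
  have "{S. S a \<and> (\<forall>y\<in>Y. \<not> S y)} = Pi I ?B"
    using I by (auto simp: Pi_def subset_iff split: if_splits)
  then have "measure_pmf.prob (Pi_pmf I dflt (\<lambda>_. bernoulli_pmf q)) {S. S a \<and> (\<forall>y\<in>Y. \<not> S y)}
      = (\<Prod>x\<in>I. measure_pmf.prob (bernoulli_pmf q) (?B x))"
    using measure_Pi_pmf_Pi[OF I(1), of dflt "\<lambda>_. bernoulli_pmf q" ?B] by simp
  also have "\<dots> = (\<Prod>x\<in>insert a Y. measure_pmf.prob (bernoulli_pmf q) (?B x))"
    using I by (intro prod.mono_neutral_right) auto
  also have "\<dots> = measure_pmf.prob (bernoulli_pmf q) {True} *
      (\<Prod>x\<in>Y. measure_pmf.prob (bernoulli_pmf q) {False})"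
    using I finite_subset[OF I(3,1)] by (subst prod.insert) (auto intro!: arg_cong2[where f = "(*)"] prod.cong simp del: prod_constant)
  also have "\<dots> = q * (1 - q) ^ card Y"
    using q by (simp add: measure_pmf_single)
  finally show ?thesis .
qed

section \<open>Random colour lists\<close>

definition closed_out :: "('a, 'b) pre_digraph \<Rightarrow> 'a \<Rightarrow> 'a set" where
  "closed_out G u = insert u (head G ` out_arcs G u)"

text \<open>A cell \<open>(v, c)\<close> stands for the random choice whether the colour \<open>c\<close> enters the list of \<open>v\<close>.\<close>

definition conflict_cells :: "('a, 'b) pre_digraph \<Rightarrow> ('b \<Rightarrow> 'c \<times> 'c) \<Rightarrow> 'a \<Rightarrow> 'c \<Rightarrow> ('a \<times> 'c) set" where
  "conflict_cells G f u c = (\<lambda>e. (head G e, snd (f e))) ` {e \<in> out_arcs G u. fst (f e) = c}"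

definition usable :: "('a, 'b) pre_digraph \<Rightarrow> ('b \<Rightarrow> 'c \<times> 'c) \<Rightarrow> 'a \<Rightarrow> 'c \<Rightarrow> ('a \<times> 'c \<Rightarrow> bool) set" where
  "usable G f u c = {S. S (u, c) \<and> (\<forall>y \<in> conflict_cells G f u c. \<not> S y)}"

lemma determined_by_usable:
  "determined_by (insert (u, c) (conflict_cells G f u c)) (usable G f u c)"
  unfolding determined_by_def usable_def by auto

context oriented_graph
begin

section \<open>Degree bounds and overlapping closed out-neighbourhoods\<close>

lemma out_degree_le: "u \<in> verts G \<Longrightarrow> card (out_arcs G u) \<le> max_out_degree G"
  unfolding max_out_degree_def by (fold out_degree_def) (rule Max_ge, auto)

lemma in_plus_out_degree_le:
  assumes "u \<in> verts G"
  shows "card (in_arcs G u) + card (out_arcs G u) \<le> max_degree G"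
proof -
  have "in_arcs G u \<inter> out_arcs G u = {}" using no_loops by fastforce
  then have "card (in_arcs G u) + card (out_arcs G u) = vertex_degree G u"
    unfolding vertex_degree_def by (intro card_Un_disjoint[symmetric]) auto
  also have "\<dots> \<le> max_degree G"
    unfolding max_degree_def using assms by (intro Max_ge) auto
  finally show ?thesis .
qed

text \<open>An overlapping \<open>w\<close> has an arc to \<open>u\<close>, or is an out-neighbour
  of \<open>u\<close>, or shares an out-neighbour with \<open>u\<close>. This is the dependency
  count for the local lemma.\<close>

lemma card_closed_out_overlap_less:
  assumes u: "u \<in> verts G" and d: "max_out_degree G \<le> d" "0 < d" and pos: "0 < max_degree G"
  shows "card {w \<in> verts G. w \<noteq> u \<and> closed_out G w \<inter> closed_out G u \<noteq> {}} < (d + 1) * max_degree G"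
proof -
  let ?\<Delta> = "max_degree G"
  let ?H = "head G ` out_arcs G u"
  \<comment> \<open>Each out-neighbour \<open>v\<close> accounts for itself and its other
    in-neighbours; leaving out \<open>u\<close> makes room for \<open>v\<close>, so the bound stays
    \<open>?\<Delta>\<close>.\<close>
  let ?W = "\<lambda>v. insert v (tail G ` in_arcs G v - {u})"
  have sub: "{w \<in> verts G. w \<noteq> u \<and> closed_out G w \<inter> closed_out G u \<noteq> {}} \<subseteq>
      tail G ` in_arcs G u \<union> (\<Union>v\<in>?H. ?W v)"
    by (auto simp: closed_out_def)
  have W: "card (?W v) \<le> ?\<Delta>" if v: "v \<in> ?H" for v
  proof -
    obtain e where e: "e \<in> arcs G" "tail G e = u" "head G e = v" using v by auto
    then have ut: "u \<in> tail G ` in_arcs G v" by force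
    have fin: "finite (tail G ` in_arcs G v)" by auto
    have "card (?W v) \<le> Suc (card (tail G ` in_arcs G v - {u}))"
      by (rule card_insert_le_m1) (use fin in auto)
    also have "\<dots> = card (tail G ` in_arcs G v)"
      using ut fin by (rule card_Suc_Diff1[OF _ _, rotated])
    also have "\<dots> \<le> card (in_arcs G v)" by (intro card_image_le) auto
    also have "\<dots> \<le> ?\<Delta>" using in_plus_out_degree_le[of v] e head_in_verts by fastforce
    finally show ?thesis .
  qed
  have "card {w \<in> verts G. w \<noteq> u \<and> closed_out G w \<inter> closed_out G u \<noteq> {}}
      \<le> card (tail G ` in_arcs G u \<union> (\<Union>v\<in>?H. ?W v))"
    using sub by (intro card_mono) auto
  also have "\<dots> \<le> card (tail G ` in_arcs G u) + card (\<Union>v\<in>?H. ?W v)" by (rule card_Un_le)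
  also have "\<dots> \<le> card (in_arcs G u) + (\<Sum>v\<in>?H. card (?W v))"
    by (intro add_mono card_image_le card_UN_le) auto
  also have "(\<Sum>v\<in>?H. card (?W v)) \<le> card ?H * ?\<Delta>"
    using sum_bounded_above[of ?H "\<lambda>v. card (?W v)" ?\<Delta>] W by simp
  also have "card ?H * ?\<Delta> \<le> card (out_arcs G u) * ?\<Delta>"
    by (intro mult_right_mono card_image_le) auto
  finally have le: "card {w \<in> verts G. w \<noteq> u \<and> closed_out G w \<inter> closed_out G u \<noteq> {}}
      \<le> card (in_arcs G u) + card (out_arcs G u) * ?\<Delta>" by simp
  have deg: "card (in_arcs G u) + card (out_arcs G u) \<le> ?\<Delta>" by (rule in_plus_out_degree_le[OF u])
  have out: "card (out_arcs G u) \<le> d" using out_degree_le[OF u] d(1) by simp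
  \<comment> \<open>Strictness comes from \<open>0 < d\<close> if no arc leaves \<open>u\<close>;
    otherwise an outgoing arc pushes the in-degree below \<open>?\<Delta>\<close>.\<close>
  have "card (in_arcs G u) + card (out_arcs G u) * ?\<Delta> < (d + 1) * ?\<Delta>"
  proof (cases "card (out_arcs G u) = 0")
    case True
    have "card (in_arcs G u) \<le> ?\<Delta>" using deg by simp
    also have "\<dots> < (d + 1) * ?\<Delta>" using d(2) pos by simp
    finally show ?thesis unfolding True by simp
  next
    case False
    then have "card (in_arcs G u) < ?\<Delta>" using deg by simp
    moreover have "card (out_arcs G u) * ?\<Delta> \<le> d * ?\<Delta>" using out by simp
    ultimately have "card (in_arcs G u) + card (out_arcs G u) * ?\<Delta> < ?\<Delta> + d * ?\<Delta>"
      by (rule add_less_le_mono)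
    then show ?thesis by simp
  qed
  with le show ?thesis by simp
qed

text \<open>Independence over colours gives a product; \<open>1 - x \<le> exp (- x)\<close> makes it
  a sum in the exponent, and Bernoulli's inequality linearises each term, so that only the total
  number of outgoing arcs matters.\<close>

lemma no_usable_colour_prob_le:
  fixes C :: "'c set"
  assumes u: "u \<in> verts G" and C: "finite C" and f: "\<forall>e \<in> arcs G. f e \<in> C \<times> C"
    and ur: "uniquely_restrictive G f" and q: "0 \<le> q" "q \<le> 1"
  shows "measure_pmf.prob (Pi_pmf (verts G \<times> C) False (\<lambda>_. bernoulli_pmf q)) (\<Inter>c\<in>C. - usable G f u c)
    \<le> exp (- (q * (real (card C) - q * real (card (out_arcs G u)))))"
proof -
  let ?I = "verts G \<times> C"
  let ?P = "measure_pmf.prob (Pi_pmf ?I False (\<lambda>_. bernoulli_pmf q))"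
  let ?Y = "conflict_cells G f u"
  let ?O = "\<lambda>c. {e \<in> out_arcs G u. fst (f e) = c}"
  have Ysub: "?Y c \<subseteq> ?I" for c using f by (fastforce simp: conflict_cells_def)
  have notin: "(u, c) \<notin> ?Y c'" for c c' using no_loops by (auto simp: conflict_cells_def)
  \<comment> \<open>A common cell comes from two parallel arcs with the same conflict colour at
    their head; unique restrictiveness there forces the same colour at \<open>u\<close>.\<close>
  have disj: "?Y c \<inter> ?Y c' = {}" if "c \<noteq> c'" for c c'
  proof -
    have False if e: "e1 \<in> arcs G" "tail G e1 = u" "fst (f e1) = c"
        "e2 \<in> arcs G" "tail G e2 = u" "fst (f e2) = c'"
        "head G e1 = head G e2" "snd (f e1) = snd (f e2)" for e1 e2
    proof -
      have "uniquely_restrictive_at G f (head G e1)"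
        using ur e unfolding uniquely_restrictive_def by simp
      moreover have "cc G f (head G e1) e1 = cc G f (head G e1) e2"
        using e no_loops[of e1] by (simp add: cc_def)
      ultimately have "cc G f u e1 = cc G f u e2"
        using e unfolding uniquely_restrictive_at_def parallel_arcs_def by (metis in_in_arcs_conv)
      then show False using e \<open>c \<noteq> c'\<close> by (simp add: cc_def)
    qed
    then show ?thesis unfolding conflict_cells_def by auto
  qed
  have "?P (\<Inter>c\<in>C. - usable G f u c) = (\<Prod>c\<in>C. ?P (- usable G f u c))"
  proof (rule Pi_pmf_prob_INT[where X = "\<lambda>c. insert (u, c) (?Y c)"])
    show "determined_by (insert (u, c) (?Y c)) (- usable G f u c)" for c
      by (intro determined_by_Compl determined_by_usable)
    show "insert (u, c) (?Y c) \<inter> insert (u, c') (?Y c') = {}" if "c \<noteq> c'" for c c'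
      using disj[OF that] notin that by auto
  qed (use C u Ysub in auto)
  also have "\<dots> = (\<Prod>c\<in>C. 1 - q * (1 - q) ^ card (?Y c))"
  proof (intro prod.cong refl)
    fix c assume "c \<in> C"
    have "?P (- usable G f u c) = 1 - ?P (usable G f u c)"
      using measure_pmf.prob_compl[of "usable G f u c" "Pi_pmf ?I False (\<lambda>_. bernoulli_pmf q)"]
      by (simp add: Compl_eq_Diff_UNIV)
    then show "?P (- usable G f u c) = 1 - q * (1 - q) ^ card (?Y c)"
      unfolding usable_def using C u Ysub notin q \<open>c \<in> C\<close>
      by (subst (asm) Pi_bernoulli_prob_single) auto
  qed
  also have "\<dots> \<le> (\<Prod>c\<in>C. exp (- (q * (1 - q) ^ card (?Y c))))"
  proof (intro prod_mono conjI)
    fix c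
    have "q * (1 - q) ^ card (?Y c) \<le> 1 * 1"
      using q by (intro mult_mono power_le_one) auto
    then show "0 \<le> 1 - q * (1 - q) ^ card (?Y c)" by simp
    show "1 - q * (1 - q) ^ card (?Y c) \<le> exp (- (q * (1 - q) ^ card (?Y c)))"
      using exp_ge_add_one_self[of "- (q * (1 - q) ^ card (?Y c))"] by simp
  qed
  also have "\<dots> = exp (- (q * (\<Sum>c\<in>C. (1 - q) ^ card (?Y c))))"
    using C by (simp add: exp_sum[symmetric] sum_negf sum_distrib_left)
  also have "\<dots> \<le> exp (- (q * (real (card C) - q * real (card (out_arcs G u)))))"
  proof -
    \<comment> \<open>The outgoing arcs are sorted into disjoint classes by their conflict colour at
      \<open>u\<close>.\<close>
    have "real (card (out_arcs G u)) \<ge> (\<Sum>c\<in>C. real (card (?O c)))"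
    proof -
      have "(\<Sum>c\<in>C. card (?O c)) = card (\<Union>c\<in>C. ?O c)"
        using C by (intro card_UN_disjoint[symmetric]) auto
      also have "\<dots> \<le> card (out_arcs G u)" by (intro card_mono) auto
      finally show ?thesis by (metis of_nat_le_iff of_nat_sum)
    qed
    then have "real (card C) - q * real (card (out_arcs G u)) \<le> (\<Sum>c\<in>C. 1 - q * real (card (?O c)))"
      using q by (simp add: sum_subtractf sum_distrib_left[symmetric] mult_left_mono)
    also have "\<dots> \<le> (\<Sum>c\<in>C. (1 - q) ^ card (?Y c))"
    proof (rule sum_mono)
      fix c
      \<comment> \<open>Several arcs may yield the same cell, so cells are at most as many as
        arcs.\<close>
      have "1 - q * real (card (?O c)) \<le> 1 + real (card (?Y c)) * (- q)"
        using q unfolding conflict_cells_def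
        by (auto simp: mult.commute intro!: mult_left_mono card_image_le)
      also have "\<dots> \<le> (1 + - q) ^ card (?Y c)"
        using q by (intro Bernoulli_inequality) auto
      finally show "1 - q * real (card (?O c)) \<le> (1 - q) ^ card (?Y c)" by simp
    qed
    finally show ?thesis using q by (simp add: mult_left_mono)
  qed
  finally show ?thesis .
qed

text \<open>On a violated arc, usability at the head puts the cell of the head and its colour into
  \<open>S\<close>, while usability at the tail keeps it out.\<close>

lemma usable_colours_imp_coloring:
  assumes "\<And>u. u \<in> verts G \<Longrightarrow> \<exists>c\<in>C. S \<in> usable G f u c"
  shows "\<exists>\<phi>. single_conflict_coloring G f C \<phi>"
proof -
  obtain \<phi> where \<phi>: "\<And>u. u \<in> verts G \<Longrightarrow> \<phi> u \<in> C \<and> S \<in> usable G f u (\<phi> u)"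
    using assms by metis
  have "(\<phi> (tail G e), \<phi> (head G e)) \<noteq> f e" if e: "e \<in> arcs G" for e
  proof
    assume eq: "(\<phi> (tail G e), \<phi> (head G e)) = f e"
    then have "fst (f e) = \<phi> (tail G e)" "snd (f e) = \<phi> (head G e)" by (metis fst_conv, metis snd_conv)
    then have "(head G e, \<phi> (head G e)) \<in> conflict_cells G f (tail G e) (\<phi> (tail G e))"
      using e by (force simp: conflict_cells_def)
    then show False
      using \<phi>[of "tail G e"] \<phi>[of "head G e"] e by (auto simp: usable_def)
  qed
  then show ?thesis using \<phi> unfolding single_conflict_coloring_def by blast
qed

text \<open>Pigeonhole at each tail. This leaves \<open>card C \<le> d\<close> for the random
  argument, where \<open>q\<close> is then a probability.\<close>

lemma exists_coloring_if_many_colours: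
  assumes "finite C" "max_out_degree G < card C"
  shows "\<exists>\<phi>. single_conflict_coloring G f C \<phi>"
proof -
  have "\<exists>c\<in>C. c \<notin> (\<lambda>e. fst (f e)) ` out_arcs G u" if "u \<in> verts G" for u
  proof (rule ccontr)
    assume "\<not> ?thesis"
    then have "card C \<le> card ((\<lambda>e. fst (f e)) ` out_arcs G u)" by (intro card_mono) auto
    also have "\<dots> \<le> card (out_arcs G u)" by (intro card_image_le) auto
    also have "\<dots> \<le> max_out_degree G" by (rule out_degree_le[OF that])
    finally show False using assms by simp
  qed
  then obtain \<phi> where \<phi>: "\<And>u. u \<in> verts G \<Longrightarrow> \<phi> u \<in> C \<and> \<phi> u \<notin> (\<lambda>e. fst (f e)) ` out_arcs G u"
    by metis
  have "(\<phi> (tail G e), \<phi> (head G e)) \<noteq> f e" if e: "e \<in> arcs G" for e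
    using \<phi>[of "tail G e"] e by (metis fst_conv image_eqI in_out_arcs_conv tail_in_verts)
  then show ?thesis using \<phi> unfolding single_conflict_coloring_def by blast
qed

lemma exists_coloring_if_few_colours:
  fixes C :: "'c set"
  assumes C: "finite C" and f: "\<forall>e \<in> arcs G. f e \<in> C \<times> C" and ur: "uniquely_restrictive G f"
    and d: "max_out_degree G \<le> d" "0 < d" and pos: "0 < max_degree G"
    and kd: "card C \<le> d"
    and k: "4 * (real d * (1 + ln (real ((d + 1) * max_degree G)))) \<le> (real (card C))\<^sup>2"
  shows "\<exists>\<phi>. single_conflict_coloring G f C \<phi>"
proof -
  define k where "k = real (card C)"
  define D where "D = (d + 1) * max_degree G"
  \<comment> \<open>This value maximises \<open>q * (k - q * d)\<close>, with maximum
    \<open>k\<^sup>2 / (4 * d)\<close>.\<close>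
  define q where "q = k / (2 * real d)"
  define p where "p = Pi_pmf (verts G \<times> C) False (\<lambda>_. bernoulli_pmf q)"
  define N where "N = (\<lambda>u. {w \<in> verts G. w \<noteq> u \<and> closed_out G w \<inter> closed_out G u \<noteq> {}})"
  define B where "B = (\<lambda>u. \<Inter>c\<in>C. - usable G f u c)"
  let ?X = "\<lambda>u. closed_out G u \<times> C"
  have q: "0 \<le> q" "q \<le> 1" using kd d(2) by (auto simp: q_def k_def field_simps)
  have D2: "2 \<le> D" using mult_le_mono[of 2 "d + 1" 1 "max_degree G"] d pos by (simp add: D_def)
  have B_prob: "measure_pmf.prob p (B u) \<le> 1 / (exp 1 * real D)" if u: "u \<in> verts G" for u
  proof -
    have "measure_pmf.prob p (B u) \<le> exp (- (q * (k - q * real (card (out_arcs G u)))))"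
      unfolding p_def B_def k_def using u C f ur q by (rule no_usable_colour_prob_le)
    also have "\<dots> \<le> exp (- (1 + ln (real D)))"
    proof -
      have "q * real (card (out_arcs G u)) \<le> q * real d"
        using out_degree_le[OF u] d(1) q by (intro mult_left_mono) auto
      also have "\<dots> = k / 2" using d(2) by (simp add: q_def)
      finally have "q * (k / 2) \<le> q * (k - q * real (card (out_arcs G u)))"
        using q by (intro mult_left_mono) auto
      moreover have "q * (k / 2) = k\<^sup>2 / (4 * real d)"
        by (simp add: q_def power2_eq_square)
      moreover have "1 + ln (real D) \<le> k\<^sup>2 / (4 * real d)"
        using k d(2) by (simp add: k_def D_def field_simps)
      ultimately show ?thesis by simp
    qed
    also have "\<dots> = 1 / (exp 1 * real D)"
      using D2 by (simp add: exp_diff exp_minus inverse_eq_divide)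
    finally show ?thesis .
  qed
  have usable_X: "insert (u, c) (conflict_cells G f u c) \<subseteq> ?X u" if "c \<in> C" for u c
    using that f by (fastforce simp: closed_out_def conflict_cells_def)
  have B_det: "determined_by (?X u) (B u)" for u
  proof -
    have "determined_by (?X u) (usable G f u c)" if "c \<in> C" for c
      using usable_X[OF that] determined_by_usable by (rule determined_by_mono)
    then have "determined_by (\<Union>c\<in>C. ?X u) (B u)"
      unfolding B_def
      by (intro determined_by_INT[where X = "\<lambda>_. ?X u" and E = "\<lambda>c. - usable G f u c"] determined_by_Compl)
    then show ?thesis unfolding determined_by_def by auto
  qed
  have X_sub: "?X u \<subseteq> verts G \<times> C" if "u \<in> verts G" for u
    using that by (auto simp: closed_out_def)
  have "measure_pmf.prob p (space (measure_pmf p) - (\<Union>u\<in>verts G. B u)) > 0"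
  proof (rule measure_pmf.lovasz_local_lemma_symmetric[where N = N and D = D])
    fix u J assume uJ: "u \<in> verts G" "J \<subseteq> verts G - N u - {u}"
    \<comment> \<open>Outside \<open>N u\<close> and \<open>u\<close> itself, closed
      out-neighbourhoods are disjoint from that of \<open>u\<close>, so the bad events read disjoint
      sets of cells.\<close>
    have "measure_pmf.prob p (B u \<inter> (\<Inter>w\<in>J. - B w)) =
        measure_pmf.prob p (B u) * measure_pmf.prob p (\<Inter>w\<in>J. - B w)"
      unfolding p_def
    proof (rule Pi_pmf_prob_Int)
      show "?X u \<inter> (\<Union>w\<in>J. ?X w) = {}" using uJ(2) unfolding N_def by blast
      show "determined_by (\<Union>w\<in>J. ?X w) (\<Inter>w\<in>J. - B w)"
        by (intro determined_by_INT[where X = ?X and E = "\<lambda>w. - B w"] determined_by_Compl B_det)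
    qed (use C uJ X_sub B_det in auto)
    moreover have "(\<Inter>w\<in>J. - B w) = space (measure_pmf p) - (\<Union>w\<in>J. B w)" by auto
    ultimately show "measure_pmf.prob p (B u \<inter> (space (measure_pmf p) - (\<Union>w\<in>J. B w))) =
        measure_pmf.prob p (B u) * measure_pmf.prob p (space (measure_pmf p) - (\<Union>w\<in>J. B w))"
      by simp
  next
    show "card (N u) < D" if "u \<in> verts G" for u
      unfolding N_def D_def using that d pos by (rule card_closed_out_overlap_less)
  qed (use D2 B_prob in \<open>auto simp: N_def\<close>)
  then have "space (measure_pmf p) - (\<Union>u\<in>verts G. B u) \<noteq> {}" by (metis less_irrefl measure_empty)
  then obtain S where "\<And>u. u \<in> verts G \<Longrightarrow> S \<notin> B u" by auto
  then show ?thesis by (intro usable_colours_imp_coloring[where S = S]) (auto simp: B_def)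
qed

end

section \<open>Combining the cases of many and few colours\<close>

theorem theorem2p2:
  fixes G :: "('a, 'b) pre_digraph" and f :: "'b \<Rightarrow> 'c \<times> 'c" and C :: "'c set"
    and \<Delta> d k :: nat
  assumes "oriented_graph G"
    and "max_degree G = \<Delta>"
    and "max_out_degree G \<le> d"
    and "finite C" and "card C = k" and "C \<noteq> {}"
    and "\<forall>e \<in> arcs G. f e \<in> C \<times> C"
    and "uniquely_restrictive G f"
    and "real k \<ge> 2 * sqrt (real d * (1 + ln ((real d + 1) * real \<Delta>)))"
  shows "\<exists>\<phi>. single_conflict_coloring G f C \<phi>"
proof -
  interpret oriented_graph G by fact
  show ?thesis
  proof (cases "max_out_degree G < k")
    case True
    then show ?thesis using exists_coloring_if_many_colours assms(4,5) by metis
  next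
    case False
    have "0 < k" using assms(4-6) by (metis card_gt_0_iff)
    then have d: "0 < d" and kd: "k \<le> d" using False assms(3) by auto
    \<comment> \<open>This excludes \<open>ln 0\<close>, whose value is only a convention: without
      arcs the maximum out-degree would be 0, hence below \<open>k\<close>.\<close>
    have "\<Delta> \<noteq> 0"
    proof
      assume "\<Delta> = 0"
      then have "max_out_degree G = 0"
        using in_plus_out_degree_le assms(2) by (auto simp: max_out_degree_def out_degree_def image_def Max_eq_iff)
      with False \<open>0 < k\<close> show False by simp
    qed
    then have D: "0 < max_degree G" using assms(2) by simp
    let ?t = "real d * (1 + ln ((real d + 1) * real \<Delta>))"
    have "1 \<le> (real d + 1) * real \<Delta>"
      using mult_mono[of 1 "real d + 1" 1 "real \<Delta>"] \<open>\<Delta> \<noteq> 0\<close> by simp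
    \<comment> \<open>Nonnegativity makes \<open>(sqrt ?t)\<^sup>2\<close> equal to
      \<open>?t\<close>, so the hypothesis on \<open>k\<close> can be squared.\<close>
    then have "0 \<le> ?t" by (intro mult_nonneg_nonneg add_nonneg_nonneg ln_ge_zero) auto
    then have "4 * ?t = (2 * sqrt ?t)\<^sup>2" by (simp add: power_mult_distrib)
    also have "\<dots> \<le> (real k)\<^sup>2" using assms(9) \<open>0 \<le> ?t\<close> by (intro power_mono) auto
    finally show ?thesis
      using exists_coloring_if_few_colours[of C f d] assms d kd D
      by (simp add: algebra_simps)
  qed
qed

end
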